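(* $$\sum_{n=1}^{\infty}\frac{1}{2^n}\sum_{k=1}^{n}\binom{n}{k}\frac{H_k^{(3)}}{k^3}=\zeta^2(3)+\zeta(6).$$
   Context: $H_k^{(r)}=\sum_{j=1}^k \frac{1}{j^r}$ denotes the generalized harmonic number, $\zeta$ is the Riemann zeta function, and $\zeta^2(3)=(\zeta(3))^2$. *)

theory Defs
  imports "HOL-Analysis.Analysis"
begin

definition gen_harm :: "nat \<Rightarrow> nat \<Rightarrow> real" where
  "gen_harm r k = (\<Sum>j=1..k. 1 / real j ^ r)"

text \<open>
  The Riemann zeta function at real arguments, given by its Dirichlet series (index shifted
  to start at 1). This is the zeta function only for \<open>s > 1\<close>, where the series converges;
  no analytic continuation is encoded.
\<close>
definition zeta :: "real \<Rightarrow> real" where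
  "zeta s = (\<Sum>n. 1 / real (Suc n) powr s)"

end

theory Submission
  imports Defs "HOL-Real_Asymp.Real_Asymp"
begin

text \<open>
  All terms are nonnegative, so the double series may be summed over \<open>n\<close> first; as
  \<open>\<Sum>n. (n choose k) / 2 ^ n = 2\<close> for every \<open>k\<close>, it equals \<open>2 (\<Sum>k. H\<^sub>k / k\<^sup>3)\<close> with
  \<open>H\<^sub>k = (\<Sum>j\<le>k. 1 / j\<^sup>3)\<close>. Symmetry in \<open>j\<close> and \<open>k\<close> turns this into the full square
  \<open>\<Sum>j k. 1 / (j\<^sup>3 k\<^sup>3)\<close> plus one extra copy of the diagonal.
\<close>

lemma binomial_over_two_power_tendsto_0:
  "(\<lambda>n. real (n choose k) / 2 ^ n) \<longlonglongrightarrow> 0"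
proof (rule tendsto_sandwich)
  show "\<forall>\<^sub>F n in sequentially. 0 \<le> real (n choose k) / 2 ^ n"
    by simp
  show "\<forall>\<^sub>F n in sequentially. real (n choose k) / 2 ^ n \<le> real n ^ k / 2 ^ n"
    using eventually_ge_at_top[of k]
  proof eventually_elim
    case (elim n)
    then have "real (n choose k) \<le> real n ^ k"
      using binomial_le_pow[of k n] by (metis of_nat_le_iff of_nat_power)
    then show ?case
      by (simp add: divide_right_mono)
  qed
  show "(\<lambda>n. real n ^ k / 2 ^ n) \<longlonglongrightarrow> 0"
    by real_asymp
qed simp

text \<open>Pascal's rule, summed over \<open>n\<close> and telescoped. The boundary term vanishes
  as \<open>m\<close> grows, so the full series has the same value for \<open>Suc k\<close> as for
  \<open>k\<close>, which reduces every case to the geometric series.\<close>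

lemma sum_binomial_Suc_over_two_power:
  "(\<Sum>n<m. real (n choose Suc k) / 2 ^ n) =
     (\<Sum>n<m. real (n choose k) / 2 ^ n) - 2 * (real (m choose Suc k) / 2 ^ m)"
  by (induction m) (simp_all add: add_divide_distrib)

lemma binomial_over_two_power_sums: "(\<lambda>n. real (n choose k) / 2 ^ n) sums 2"
proof (induction k)
  case 0
  show ?case
    using geometric_sums[of "1 / 2 :: real"] by (simp add: power_one_over)
next
  case (Suc k)
  have "(\<lambda>m. (\<Sum>n<m. real (n choose k) / 2 ^ n) - 2 * (real (m choose Suc k) / 2 ^ m))
          \<longlonglongrightarrow> 2 - 2 * 0"
    using Suc.IH unfolding sums_def
    by (intro tendsto_intros binomial_over_two_power_tendsto_0)
  then show ?case
    unfolding sums_def sum_binomial_Suc_over_two_power by simp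
qed

lemma sums_binomial_transform:
  fixes c :: "nat \<Rightarrow> real"
  assumes nonneg: "\<And>k. 0 \<le> c k" and "c sums s"
  shows "(\<lambda>n. 1 / 2 ^ n * (\<Sum>k\<le>n. real (n choose k) * c k)) sums (2 * s)"
proof -
  let ?f = "\<lambda>(k, n). c k * (real (n choose k) / 2 ^ n)"
  have inner: "((\<lambda>n. ?f (k, n)) has_sum c k * 2) UNIV" for k
    unfolding prod.case using nonneg
    by (intro sums_nonneg_imp_has_sum sums_mult binomial_over_two_power_sums) auto
  have outer: "((\<lambda>k. c k * 2) has_sum s * 2) UNIV"
    using nonneg by (intro sums_nonneg_imp_has_sum sums_mult2 \<open>c sums s\<close>) auto
  \<comment> \<open>Tonelli: for nonnegative terms, summable row sums give summability over all
    pairs, and so the freedom to swap the order.\<close>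
  have "?f summable_on UNIV \<times> UNIV"
    using inner has_sum_imp_summable[OF outer] nonneg
    by (intro summable_on_SigmaI[where g = "\<lambda>k. c k * 2"]) auto
  with inner outer have "(?f has_sum s * 2) (UNIV \<times> UNIV)"
    by (intro has_sum_SigmaI[where g = "\<lambda>k. c k * 2"])
  then have "((\<lambda>(n, k). ?f (k, n)) has_sum s * 2) (UNIV \<times> UNIV)"
    by (subst (asm) has_sum_swap)
  then have "((\<lambda>n. 1 / 2 ^ n * (\<Sum>k\<le>n. real (n choose k) * c k)) has_sum s * 2) UNIV"
  proof (rule has_sum_SigmaD)
    fix n :: nat
    show "((\<lambda>k. (\<lambda>(n, k). ?f (k, n)) (n, k)) has_sum
            1 / 2 ^ n * (\<Sum>k\<le>n. real (n choose k) * c k)) UNIV"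
      \<comment> \<open>The binomial coefficient is zero for \<open>k > n\<close>.\<close>
      by (rule has_sum_finite_neutralI[where B = "{..n}"])
        (auto simp: sum_distrib_left mult_ac intro!: sum.cong)
  qed
  then show ?thesis
    using has_sum_imp_sums by (simp add: mult.commute)
qed

text \<open>The index \<open>k = 0\<close> contributes \<open>1 / 0 = 0\<close>.\<close>
lemma zeta_sums:
  assumes "r \<ge> 2"
  shows "(\<lambda>k. 1 / real k ^ r) sums zeta (real r)"
proof -
  have eq: "1 / real (Suc k) powr real r = 1 / real (Suc k) ^ r" for k
    by (subst powr_realpow) auto
  have "summable (\<lambda>k. 1 / real (Suc k) ^ r)"
    using inverse_power_summable[OF assms, where 'a = real]
    by (subst summable_Suc_iff) (simp add: inverse_eq_divide)
  then have "(\<lambda>k. 1 / real (Suc k) ^ r) sums zeta (real r)"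
    unfolding zeta_def eq by (rule summable_sums)
  then show ?thesis
    using assms by (subst (asm) sums_Suc_iff) (simp add: power_0_left)
qed

lemma gen_harm_Suc: "gen_harm r (Suc k) = gen_harm r k + 1 / real (Suc k) ^ r"
  by (simp add: gen_harm_def)

lemma gen_harm_eq_sum:
  assumes "r > 0"
  shows "gen_harm r m = (\<Sum>k<Suc m. 1 / real k ^ r)"
  using assms by (induction m) (simp_all add: gen_harm_Suc, simp add: gen_harm_def)

text \<open>Finite form of the symmetry: the triangles j \<le> k and k \<le> j have equal sums and
  together cover the square of index pairs, with the diagonal counted twice.\<close>

lemma sum_gen_harm_over_power:
  assumes "r > 0"
  shows "2 * (\<Sum>k<Suc m. gen_harm r k / real k ^ r) =
           (gen_harm r m)\<^sup>2 + (\<Sum>k<Suc m. 1 / real k ^ (2 * r))"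
proof (induction m)
  case 0
  show ?case
    using assms by (simp add: gen_harm_def)
next
  case (Suc m)
  let ?a = "1 / real (Suc m) ^ r" and ?h = "gen_harm r m"
  have "2 * (\<Sum>k<Suc (Suc m). gen_harm r k / real k ^ r) =
          ?h\<^sup>2 + (\<Sum>k<Suc m. 1 / real k ^ (2 * r)) + 2 * ((?h + ?a) * ?a)"
    using Suc.IH by (simp add: gen_harm_Suc)
  also have "\<dots> = (?h + ?a)\<^sup>2 + ((\<Sum>k<Suc m. 1 / real k ^ (2 * r)) + ?a\<^sup>2)"
    by (simp add: power2_eq_square algebra_simps)
  also have "?a\<^sup>2 = 1 / real (Suc m) ^ (2 * r)"
    by (simp add: power_one_over power_mult mult.commute flip: power_mult)
  finally show ?case
    by (simp add: gen_harm_Suc)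
qed

lemma gen_harm_over_power_sums:
  assumes "r \<ge> 2"
  shows "(\<lambda>k. gen_harm r k / real k ^ r) sums (((zeta r)\<^sup>2 + zeta (2 * r)) / 2)"
proof -
  have "r > 0"
    using assms by simp
  have "gen_harm r \<longlonglongrightarrow> zeta r"
    \<comment> \<open>The shift turns partial sums over \<open>k < m\<close> into sums over
      \<open>k < Suc m\<close>, which are \<open>gen_harm r m\<close> because the term at 0 is
      zero.\<close>
    using LIMSEQ_Suc[OF zeta_sums[OF assms, unfolded sums_def]]
    unfolding gen_harm_eq_sum[OF \<open>r > 0\<close>, symmetric] .
  moreover have "(\<lambda>m. \<Sum>k<Suc m. 1 / real k ^ (2 * r)) \<longlonglongrightarrow> zeta (2 * r)"
    using LIMSEQ_Suc[OF zeta_sums[of "2 * r", unfolded sums_def]] assms by simp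
  ultimately have "(\<lambda>m. ((gen_harm r m)\<^sup>2 + (\<Sum>k<Suc m. 1 / real k ^ (2 * r))) / 2)
      \<longlonglongrightarrow> ((zeta r)\<^sup>2 + zeta (2 * r)) / 2"
    by (intro tendsto_intros) simp_all
  then have "(\<lambda>m. \<Sum>k<Suc m. gen_harm r k / real k ^ r)
      \<longlonglongrightarrow> ((zeta r)\<^sup>2 + zeta (2 * r)) / 2"
    by (simp del: sum.lessThan_Suc flip: sum_gen_harm_over_power[OF \<open>r > 0\<close>])
  then show ?thesis
    unfolding sums_def by (rule LIMSEQ_imp_Suc)
qed

theorem theorem4p12:
  shows "(\<lambda>n. 1 / 2 ^ Suc n *
            (\<Sum>k=1..Suc n. real (Suc n choose k) * (gen_harm 3 k / real k ^ 3)))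
          sums ((zeta 3)\<^sup>2 + zeta 6)"
proof -
  let ?c = "\<lambda>k. gen_harm 3 k / real k ^ 3"
  let ?t = "\<lambda>n. 1 / 2 ^ n * (\<Sum>k\<le>n. real (n choose k) * ?c k)"
  have "?c sums (((zeta 3)\<^sup>2 + zeta 6) / 2)"
    using gen_harm_over_power_sums[of 3] by simp
  then have "?t sums (2 * (((zeta 3)\<^sup>2 + zeta 6) / 2))"
    by (intro sums_binomial_transform) (simp_all add: gen_harm_def sum_nonneg)
  then have "?t sums ((zeta 3)\<^sup>2 + zeta 6)"
    by (simp only: mult_2 field_sum_of_halves)
  \<comment> \<open>Dropping the term at \<open>n = 0\<close> keeps the value: \<open>?c 0\<close>
    is a division by zero, hence 0. The same fact removes \<open>k = 0\<close> from the inner sum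
    below.\<close>
  then have "(\<lambda>n. ?t (Suc n)) sums ((zeta 3)\<^sup>2 + zeta 6)"
    by (subst sums_Suc_iff) simp
  moreover have "(\<Sum>k\<le>Suc n. real (Suc n choose k) * ?c k) =
      (\<Sum>k=1..Suc n. real (Suc n choose k) * ?c k)" for n
    by (rule sum.mono_neutral_right) (auto simp: Suc_le_eq)
  ultimately show ?thesis
    by (simp only:)
qed

end
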